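(* Let $k$ be a positive integer, let $\mathcal{A}$ be a monotone family of subsets of $[n]$ with minterms of size at most $k$, and let $p\in[0,1]$. Then at least one of the following two possibilities holds. (1) There exists a subfamily $\mathcal{B}\subseteq\mathcal{A}$ (monotone, with all minterms of size at most $k$), with $\mu_p(\mathcal{B})\ge \mu_p(\mathcal{A})/2$, which is tame with respect to $p/2$. (2) There exist an integer $m$ with $1\le m\le k-1$ and a monotone family $\mathcal{B}$ which is a tame $m$-approximation of $\mathcal{A}$ at $p/2$, with $\mu_p(\mathcal{B})\ge \mu_p(\mathcal{A})/2^{m+1}$.
   Context: Let $[n]=\{0,1,\ldots,n\}$. For $p\in[0,1]$, $\mu_p(\mathcal{A})$ is the probability that a random subset of $[n]$, containing each element independently with probability $p$, belongs to $\mathcal{A}$. A family $\mathcal{A}$ is monotone if $A\in\mathcal{A}$ and $A\subset B\subseteq [n]$ imply $B\in\mathcal{A}$. Minterms of $\mathcal{A}$ are its inclusion-minimal members; $\mathcal{M}(\mathcal{A})$ is the set of minterms. The family spanned by a collection of sets is the monotone family of all subsets of $[n]$ containing at least one set of the collection. All monotone families considered have minterms of size at most $k$ (with $k$ fixed). For $V\subset[n]$ (possibly empty) and $m\ge 1$, the family of $m$-supplements of $V$ with respect to $\mathcal{A}$ is $$N^m_{\mathcal{A}}(V)=\{W\subset[n] : |W|=m,\ W\cap V=\varnothing,\ W\cup V\in\mathcal{M}(\mathcal{A})\}.$$ A monotone family $\mathcal{A}$ with minterms of size at most $k$ is tame with respect to $p$ if for every $1\le m\le k-1$ and every $V\subset[n]$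 one has $|N^m_{\mathcal{A}}(V)|<p^{-m}$ (with $0^{-m}=+\infty$). A monotone family $\mathcal{B}$ is a tame $m$-approximation of $\mathcal{A}$ at $p$ if there is a (monotone, with minterms of size at most $k$) subfamily $\mathcal{A}'\subset\mathcal{A}$ such that for every minterm $B\in\mathcal{M}(\mathcal{B})$ the set $N^m_{\mathcal{A}'}(B)$ has size at least $p^{-m}$ and is tame with respect to $p$. Here tameness of $N^m_{\mathcal{A}'}(B)$, a collection of sets of size $m$, means that the monotone family $\mathcal{N}$ it spans, viewed as a family with minterms of size at most $m$, is tame with respect to $p$: $|N^l_{\mathcal{N}}(U)|<p^{-l}$ for all $1\le l\le m-1$ and all $U\subset[n]$. *)

theory Defs
  imports "HOL-Probability.Probability"
begin

text \<open>
  The ground set is \<open>{0..n}\<close>, which has \<open>n + 1\<close> elements. All notions carry \<open>n\<close> as a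
  parameter.
\<close>

definition random_subset :: "nat \<Rightarrow> real \<Rightarrow> nat set pmf" where
  "random_subset n p = map_pmf Collect (Pi_pmf {0..n} False (\<lambda>_. bernoulli_pmf p))"

definition mu :: "nat \<Rightarrow> real \<Rightarrow> nat set set \<Rightarrow> real" where
  "mu n p \<A> = measure_pmf.prob (random_subset n p) \<A>"

definition monotone_family :: "nat \<Rightarrow> nat set set \<Rightarrow> bool" where
  "monotone_family n \<A> \<longleftrightarrow>
     \<A> \<subseteq> Pow {0..n} \<and> (\<forall>A B. A \<in> \<A> \<longrightarrow> A \<subseteq> B \<longrightarrow> B \<subseteq> {0..n} \<longrightarrow> B \<in> \<A>)"

definition minterms :: "nat set set \<Rightarrow> nat set set" where
  "minterms \<A> = {A \<in> \<A>. \<forall>B \<in> \<A>. B \<subseteq> A \<longrightarrow> B = A}"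

definition spanned_family :: "nat \<Rightarrow> nat set set \<Rightarrow> nat set set" where
  "spanned_family n \<C> = {B. B \<subseteq> {0..n} \<and> (\<exists>C \<in> \<C>. C \<subseteq> B)}"

definition bounded_family :: "nat \<Rightarrow> nat \<Rightarrow> nat set set \<Rightarrow> bool" where
  "bounded_family n k \<A> \<longleftrightarrow> monotone_family n \<A> \<and> (\<forall>A \<in> minterms \<A>. card A \<le> k)"

definition supplements :: "nat \<Rightarrow> nat set set \<Rightarrow> nat \<Rightarrow> nat set \<Rightarrow> nat set set" where
  "supplements n \<A> m V =
     {W. W \<subseteq> {0..n} \<and> card W = m \<and> W \<inter> V = {} \<and> W \<union> V \<in> minterms \<A>}"

text \<open>
  The threshold \<open>p\<^sup>-\<^sup>m\<close>. It is valued in \<^typ>\<open>ennreal\<close>, where the inverse of \<open>0\<close> is \<open>\<infinity>\<close>,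
  so that the convention for \<open>p = 0\<close> and \<open>m \<ge> 1\<close> holds; over the reals it would be \<open>0\<close>.
\<close>

definition threshold :: "real \<Rightarrow> nat \<Rightarrow> ennreal" where
  "threshold p m = inverse (ennreal p ^ m)"

definition tame :: "nat \<Rightarrow> nat \<Rightarrow> real \<Rightarrow> nat set set \<Rightarrow> bool" where
  "tame n k p \<A> \<longleftrightarrow> bounded_family n k \<A> \<and>
     (\<forall>m V. 1 \<le> m \<longrightarrow> m \<le> k - 1 \<longrightarrow> V \<subseteq> {0..n} \<longrightarrow>
        of_nat (card (supplements n \<A> m V)) < threshold p m)"

text \<open>
  A collection of \<open>m\<close>-sets is tame if the family it spans is tame as a family with minterms of
  size at most \<open>m\<close>; hence the bound \<open>m\<close> (and not \<open>k\<close>) in the last conjunct.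
\<close>

definition tame_approximation ::
  "nat \<Rightarrow> nat \<Rightarrow> nat \<Rightarrow> real \<Rightarrow> nat set set \<Rightarrow> nat set set \<Rightarrow> bool" where
  "tame_approximation n k m p \<A> \<B> \<longleftrightarrow> bounded_family n k \<B> \<and>
     (\<exists>\<A>'. \<A>' \<subseteq> \<A> \<and> bounded_family n k \<A>' \<and>
        (\<forall>B \<in> minterms \<B>.
           of_nat (card (supplements n \<A>' m B)) \<ge> threshold p m \<and>
           tame n m p (spanned_family n (supplements n \<A>' m B))))"

end

theory Submission
  imports Defs
begin

text \<open>
  Write \<open>q = p / 2\<close> and treat \<open>m = 1, \<dots>, k - 1\<close> in turn, starting from \<open>\<A>\<^sub>0 = \<A>\<close>. Let \<open>\<B>\<^sub>m\<close> be
  spanned by the sets with at least \<open>q\<^sup>-\<^sup>m\<close> many \<open>m\<close>-supplements in \<open>\<A>\<^sub>m\<^sub>-\<^sub>1\<close>, and \<open>\<A>\<^sub>m\<close> by the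
  minterms of \<open>\<A>\<^sub>m\<^sub>-\<^sub>1\<close> outside \<open>\<B>\<^sub>m\<close>. All sets have few \<open>l\<close>-supplements in \<open>\<A>\<^sub>m\<^sub>-\<^sub>1\<close> for \<open>l < m\<close>;
  since an \<open>l\<close>-supplement of \<open>U\<close> in the family spanned by the \<open>m\<close>-supplements of \<open>B\<close> is an
  \<open>l\<close>-supplement of \<open>U \<union> B\<close>, the family \<open>\<B>\<^sub>m\<close> is a tame \<open>m\<close>-approximation. If its measure is at
  least \<open>\<mu>(\<A>) / 2\<^sup>m\<^sup>+\<^sup>1\<close> for some \<open>m\<close>, the second alternative holds. Otherwise, as
  \<open>\<A>\<^sub>m\<^sub>-\<^sub>1 \<subseteq> \<A>\<^sub>m \<union> \<B>\<^sub>m\<close>, the total loss is less than half of \<open>\<mu>(\<A>)\<close>, and \<open>\<A>\<^sub>k\<^sub>-\<^sub>1\<close> is tame.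
\<close>

definition light :: "nat \<Rightarrow> real \<Rightarrow> nat \<Rightarrow> nat set set \<Rightarrow> bool" where
  "light n q m \<A> \<longleftrightarrow> (\<forall>V \<subseteq> {0..n}. of_nat (card (supplements n \<A> m V)) < threshold q m)"

definition heavy_sets :: "nat \<Rightarrow> real \<Rightarrow> nat \<Rightarrow> nat set set \<Rightarrow> nat set set" where
  "heavy_sets n q m \<A> = {V. V \<subseteq> {0..n} \<and> threshold q m \<le> of_nat (card (supplements n \<A> m V))}"

lemma threshold_pos: "0 < threshold q m"
  by (simp add: threshold_def ennreal_inverse_positive power_eq_top_ennreal)

lemma finite_supplements: "finite (supplements n \<A> m V)"
  by (rule finite_subset[of _ "Pow {0..n}"]) (auto simp: supplements_def)

lemma minterm_below:
  assumes "finite A" "A \<in> \<A>"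
  obtains M where "M \<in> minterms \<A>" "M \<subseteq> A"
proof -
  have "finite {B \<in> \<A>. B \<subseteq> A}"
    using assms(1) by (auto intro: finite_subset[of _ "Pow A"])
  moreover have "A \<in> {B \<in> \<A>. B \<subseteq> A}"
    using assms(2) by simp
  ultimately obtain M where "M \<in> {B \<in> \<A>. B \<subseteq> A}"
    and min: "\<forall>B \<in> {B \<in> \<A>. B \<subseteq> A}. B \<subseteq> M \<longrightarrow> M = B"
    using finite_has_minimal2[of "{B \<in> \<A>. B \<subseteq> A}" A] by meson
  then have M: "M \<in> \<A>" "M \<subseteq> A"
    by simp_all
  have "M \<in> minterms \<A>"
    unfolding minterms_def
  proof (intro CollectI conjI ballI impI M(1))
    fix B
    assume "B \<in> \<A>" "B \<subseteq> M"
    with M(2) min show "B = M"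
      by (metis (mono_tags, lifting) mem_Collect_eq subset_trans)
  qed
  with M(2) show thesis
    by (rule that[rotated])
qed

lemma monotone_spanned_family: "monotone_family n (spanned_family n \<C>)"
  unfolding monotone_family_def spanned_family_def by blast

lemma minterms_spanned_family_subset:
  assumes "\<C> \<subseteq> Pow {0..n}"
  shows "minterms (spanned_family n \<C>) \<subseteq> \<C>"
  using assms unfolding minterms_def spanned_family_def by blast

lemma bounded_spanned_family:
  assumes "\<C> \<subseteq> Pow {0..n}" "\<And>C. C \<in> \<C> \<Longrightarrow> card C \<le> k"
  shows "bounded_family n k (spanned_family n \<C>)"
  unfolding bounded_family_def
  using monotone_spanned_family minterms_spanned_family_subset[OF assms(1)] assms(2) by blast

lemma supplements_mono:
  "minterms \<A> \<subseteq> minterms \<B> \<Longrightarrow> supplements n \<A> m V \<subseteq> supplements n \<B> m V"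
  by (auto simp: supplements_def)

text \<open>Supplements depend on a family only through its minterms. Inclusion of the families
  themselves would not suffice, since a smaller family can have new minterms.\<close>

lemma light_mono:
  assumes "minterms \<A> \<subseteq> minterms \<B>" "light n q m \<B>"
  shows "light n q m \<A>"
  unfolding light_def
proof (intro allI impI)
  fix V :: "nat set"
  assume "V \<subseteq> {0..n}"
  then have "of_nat (card (supplements n \<B> m V)) < threshold q m"
    using assms(2) by (simp add: light_def)
  moreover have "card (supplements n \<A> m V) \<le> card (supplements n \<B> m V)"
    by (intro card_mono finite_supplements supplements_mono assms)
  ultimately show "of_nat (card (supplements n \<A> m V)) < threshold q m"
    by (meson of_nat_mono order.strict_trans1)
qed

lemma tame_iff_light:
  "tame n k q \<A> \<longleftrightarrow> bounded_family n k \<A> \<and> (\<forall>m. 1 \<le> m \<longrightarrow> m \<le> k - 1 \<longrightarrow> light n q m \<A>)"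
  by (auto simp: tame_def light_def)

text \<open>Minterms of a spanned family are among its generators, so \<open>W \<union> U\<close> is
  itself an \<open>m\<close>-supplement of \<open>B\<close>. Its disjointness from \<open>B\<close>
  is what makes \<open>W\<close> disjoint from \<open>U \<union> B\<close>.\<close>

lemma supplements_of_supplements_subset:
  "supplements n (spanned_family n (supplements n \<A> m B)) l U \<subseteq> supplements n \<A> l (U \<union> B)"
proof
  fix W
  assume "W \<in> supplements n (spanned_family n (supplements n \<A> m B)) l U"
  then have W: "W \<subseteq> {0..n}" "card W = l" "W \<inter> U = {}"
    and "W \<union> U \<in> minterms (spanned_family n (supplements n \<A> m B))"
    by (auto simp: supplements_def)
  moreover have "supplements n \<A> m B \<subseteq> Pow {0..n}"
    by (auto simp: supplements_def)
  ultimately have "W \<union> U \<in> supplements n \<A> m B"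
    using minterms_spanned_family_subset by blast
  with W show "W \<in> supplements n \<A> l (U \<union> B)"
    by (auto simp: supplements_def Un_assoc)
qed

lemma tame_spanned_supplements:
  assumes "\<And>l. 1 \<le> l \<Longrightarrow> l < m \<Longrightarrow> light n q l \<A>" "B \<subseteq> {0..n}"
  shows "tame n m q (spanned_family n (supplements n \<A> m B))"
  unfolding tame_def
proof (intro conjI allI impI)
  show "bounded_family n m (spanned_family n (supplements n \<A> m B))"
    by (rule bounded_spanned_family) (auto simp: supplements_def)
next
  fix l U
  assume l: "1 \<le> l" "l \<le> m - 1" and U: "U \<subseteq> {0..n}"
  have "card (supplements n (spanned_family n (supplements n \<A> m B)) l U)
      \<le> card (supplements n \<A> l (U \<union> B))"
    by (intro card_mono finite_supplements supplements_of_supplements_subset)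
  moreover have "of_nat (card (supplements n \<A> l (U \<union> B))) < threshold q l"
    using assms l U by (auto simp: light_def)
  ultimately show "of_nat (card (supplements n (spanned_family n (supplements n \<A> m B)) l U))
      < threshold q l"
    by (meson of_nat_mono order.strict_trans1)
qed

text \<open>The threshold is positive, so a heavy set has at least one supplement and therefore lies
  inside a minterm of \<open>\<A>\<close>.\<close>

lemma card_heavy_set_le:
  assumes "bounded_family n k \<A>" "V \<in> heavy_sets n q m \<A>"
  shows "card V \<le> k"
proof -
  have "supplements n \<A> m V \<noteq> {}"
    using assms(2) threshold_pos[of q m] by (auto simp: heavy_sets_def)
  then obtain W where "W \<subseteq> {0..n}" and min: "W \<union> V \<in> minterms \<A>"
    by (auto simp: supplements_def)
  moreover have "V \<subseteq> {0..n}"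
    using assms(2) by (simp add: heavy_sets_def)
  ultimately have "finite (W \<union> V)"
    by (meson finite_Un finite_atLeastAtMost finite_subset)
  then have "card V \<le> card (W \<union> V)"
    by (intro card_mono) auto
  with min assms(1) show ?thesis
    by (auto simp: bounded_family_def intro: order_trans)
qed

lemma tame_approximation_heavy:
  assumes "\<A>' \<subseteq> \<A>" "bounded_family n k \<A>'" "\<And>l. 1 \<le> l \<Longrightarrow> l < m \<Longrightarrow> light n q l \<A>'"
  shows "tame_approximation n k m q \<A> (spanned_family n (heavy_sets n q m \<A>'))"
proof -
  have Pow: "heavy_sets n q m \<A>' \<subseteq> Pow {0..n}"
    by (auto simp: heavy_sets_def)
  have "bounded_family n k (spanned_family n (heavy_sets n q m \<A>'))"
    using Pow card_heavy_set_le[OF assms(2)] by (intro bounded_spanned_family)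
  moreover have "threshold q m \<le> of_nat (card (supplements n \<A>' m B))
      \<and> tame n m q (spanned_family n (supplements n \<A>' m B))"
    if "B \<in> minterms (spanned_family n (heavy_sets n q m \<A>'))" for B
    using that minterms_spanned_family_subset[OF Pow] assms(3)
    by (auto simp: heavy_sets_def intro!: tame_spanned_supplements)
  ultimately show ?thesis
    using assms(1,2) unfolding tame_approximation_def by blast
qed

text \<open>Minterms are deleted rather than members: what remains is still monotone and acquires no
  new minterms, so no supplement count can grow.\<close>

definition light_part :: "nat \<Rightarrow> real \<Rightarrow> nat \<Rightarrow> nat set set \<Rightarrow> nat set set" where
  "light_part n q m \<A> =
     spanned_family n (minterms \<A> - spanned_family n (heavy_sets n q m \<A>))"

lemma
  assumes "bounded_family n k \<A>"
  shows minterms_light_part: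
      "minterms (light_part n q m \<A>) \<subseteq> minterms \<A> - spanned_family n (heavy_sets n q m \<A>)"
    and bounded_light_part: "bounded_family n k (light_part n q m \<A>)"
    and light_part_subset: "light_part n q m \<A> \<subseteq> \<A>"
    and subset_light_part_Un:
      "\<A> \<subseteq> light_part n q m \<A> \<union> spanned_family n (heavy_sets n q m \<A>)"
proof -
  have Pow: "minterms \<A> - spanned_family n (heavy_sets n q m \<A>) \<subseteq> Pow {0..n}"
    using assms by (auto simp: bounded_family_def monotone_family_def minterms_def)
  show "minterms (light_part n q m \<A>) \<subseteq> minterms \<A> - spanned_family n (heavy_sets n q m \<A>)"
    unfolding light_part_def by (rule minterms_spanned_family_subset[OF Pow])
  show "bounded_family n k (light_part n q m \<A>)"
    unfolding light_part_def using assms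
    by (intro bounded_spanned_family Pow) (auto simp: bounded_family_def)
  show "light_part n q m \<A> \<subseteq> \<A>"
    using assms
    by (auto simp: light_part_def spanned_family_def bounded_family_def monotone_family_def
        minterms_def)
  show "\<A> \<subseteq> light_part n q m \<A> \<union> spanned_family n (heavy_sets n q m \<A>)"
  proof
    fix A
    assume "A \<in> \<A>"
    moreover from this have A: "A \<subseteq> {0..n}"
      using assms by (auto simp: bounded_family_def monotone_family_def)
    moreover have "finite A"
      using A finite_subset by blast
    ultimately obtain M where M: "M \<in> minterms \<A>" "M \<subseteq> A"
      by (meson minterm_below)
    show "A \<in> light_part n q m \<A> \<union> spanned_family n (heavy_sets n q m \<A>)"
    proof (cases "M \<in> spanned_family n (heavy_sets n q m \<A>)")
      case True
      then have "A \<in> spanned_family n (heavy_sets n q m \<A>)"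
        using monotone_spanned_family A M(2) unfolding monotone_family_def by meson
      then show ?thesis ..
    next
      case False
      then have "A \<in> light_part n q m \<A>"
        \<comment> \<open>The instantiation unfolds only the outer span and keeps the span of the
          heavy sets folded.\<close>
        unfolding light_part_def spanned_family_def[of _ "_ - _"] using A M by blast
      then show ?thesis ..
    qed
  qed
qed

lemma light_light_part:
  assumes "bounded_family n k \<A>"
  shows "light n q m (light_part n q m \<A>)"
  unfolding light_def
proof (intro allI impI)
  fix V :: "nat set"
  assume V: "V \<subseteq> {0..n}"
  note min = minterms_light_part[OF assms, of q m]
  show "of_nat (card (supplements n (light_part n q m \<A>) m V)) < threshold q m"
  proof (cases "V \<in> heavy_sets n q m \<A>")
    case True
    \<comment> \<open>Every superset of a heavy set lies in the heavy span, so no surviving minterm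
      contains \<open>V\<close>.\<close>
    then have "W \<union> V \<in> spanned_family n (heavy_sets n q m \<A>)" if "W \<subseteq> {0..n}" for W
      using that V by (auto simp: spanned_family_def)
    then have "supplements n (light_part n q m \<A>) m V = {}"
      using min by (auto simp: supplements_def)
    then show ?thesis
      by (simp add: threshold_pos)
  next
    case False
    then have "of_nat (card (supplements n \<A> m V)) < threshold q m"
      using V by (auto simp: heavy_sets_def)
    moreover have "card (supplements n (light_part n q m \<A>) m V) \<le> card (supplements n \<A> m V)"
      using min by (intro card_mono finite_supplements supplements_mono) auto
    ultimately show ?thesis
      by (meson of_nat_mono order.strict_trans1)
  qed
qed

lemma mu_subadditive:
  assumes "\<A> \<subseteq> \<B> \<union> \<C>"
  shows "mu n p \<A> \<le> mu n p \<B> + mu n p \<C>"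
proof -
  have "mu n p \<A> \<le> mu n p (\<B> \<union> \<C>)"
    unfolding mu_def using assms by (intro measure_pmf.finite_measure_mono) auto
  also have "\<dots> \<le> mu n p \<B> + mu n p \<C>"
    unfolding mu_def by (intro measure_Un_le) auto
  finally show ?thesis .
qed

text \<open>The lower bound for \<open>\<A>'\<close> starts at the full measure of
  \<open>\<A>\<close> when \<open>m = 0\<close>. Passing to \<open>Suc m\<close> lowers it by
  \<open>mu n p \<A> / 2 ^ (m + 2)\<close>, which is exactly the measure that \<open>\<B>\<close>
  must reach for the second alternative.\<close>

lemma light_subfamily_or_tame_approximation:
  assumes "bounded_family n k \<A>"
  shows "(\<exists>\<A>' \<subseteq> \<A>. bounded_family n k \<A>' \<and> (\<forall>l. 1 \<le> l \<longrightarrow> l \<le> m \<longrightarrow> light n q l \<A>')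
        \<and> mu n p \<A> / 2 + mu n p \<A> / 2 ^ (m + 1) \<le> mu n p \<A>')
    \<or> (\<exists>l \<B>. 1 \<le> l \<and> l \<le> m \<and> tame_approximation n k l q \<A> \<B>
        \<and> mu n p \<A> / 2 ^ (l + 1) \<le> mu n p \<B>)"
proof (induction m)
  case 0
  show ?case
    using assms by auto
next
  case (Suc m)
  from Suc show ?case
  proof
    assume "\<exists>l \<B>. 1 \<le> l \<and> l \<le> m \<and> tame_approximation n k l q \<A> \<B>
        \<and> mu n p \<A> / 2 ^ (l + 1) \<le> mu n p \<B>"
    then show ?thesis
      by (meson le_SucI)
  next
    assume "\<exists>\<A>' \<subseteq> \<A>. bounded_family n k \<A>' \<and> (\<forall>l. 1 \<le> l \<longrightarrow> l \<le> m \<longrightarrow> light n q l \<A>')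
        \<and> mu n p \<A> / 2 + mu n p \<A> / 2 ^ (m + 1) \<le> mu n p \<A>'"
    then obtain \<A>' where sub: "\<A>' \<subseteq> \<A>" and bdd: "bounded_family n k \<A>'"
      and light: "\<And>l. 1 \<le> l \<Longrightarrow> l \<le> m \<Longrightarrow> light n q l \<A>'"
      and mu: "mu n p \<A> / 2 + mu n p \<A> / 2 ^ (m + 1) \<le> mu n p \<A>'"
      by blast
    define \<B> where "\<B> = spanned_family n (heavy_sets n q (Suc m) \<A>')"
    have approx: "tame_approximation n k (Suc m) q \<A> \<B>"
      unfolding \<B>_def using light by (intro tame_approximation_heavy sub bdd) auto
    show ?thesis
    proof (cases "mu n p \<A> / 2 ^ (Suc m + 1) \<le> mu n p \<B>")
      case True
      with approx show ?thesis
        by (intro disjI2 exI[of _ "Suc m"] exI[of _ \<B>]) auto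
    next
      case False
      have "mu n p \<A>' \<le> mu n p (light_part n q (Suc m) \<A>') + mu n p \<B>"
        unfolding \<B>_def by (intro mu_subadditive subset_light_part_Un[OF bdd])
      with False mu
      have "mu n p \<A> / 2 + mu n p \<A> / 2 ^ (Suc m + 1) \<le> mu n p (light_part n q (Suc m) \<A>')"
        by simp
      \<comment> \<open>Only the level \<open>Suc m\<close> is new; the lower levels stay light
        because minterms are only removed.\<close>
      moreover have "light n q l (light_part n q (Suc m) \<A>')" if "1 \<le> l" "l \<le> Suc m" for l
      proof (cases "l = Suc m")
        case True
        then show ?thesis
          using light_light_part[OF bdd] by simp
      next
        case False
        with that show ?thesis
          using minterms_light_part[OF bdd, of q "Suc m"] by (intro light_mono[OF _ light]) auto
      qed
      moreover have "light_part n q (Suc m) \<A>' \<subseteq> \<A>"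
        using light_part_subset[OF bdd] sub by blast
      ultimately show ?thesis
        using bounded_light_part[OF bdd] by blast
    qed
  qed
qed

theorem theorem4p3:
  fixes n k :: nat and p :: real and \<A> :: "nat set set"
  assumes "k \<ge> 1"
    and "bounded_family n k \<A>"
    and "0 \<le> p" and "p \<le> 1"
  shows "(\<exists>\<B>. \<B> \<subseteq> \<A> \<and> bounded_family n k \<B> \<and> mu n p \<B> \<ge> mu n p \<A> / 2 \<and> tame n k (p / 2) \<B>)
    \<or> (\<exists>m \<B>. 1 \<le> m \<and> m \<le> k - 1 \<and> tame_approximation n k m (p / 2) \<A> \<B>
          \<and> mu n p \<B> \<ge> mu n p \<A> / 2 ^ (m + 1))"
proof -
  have "0 \<le> mu n p \<A> / 2 ^ (k - 1 + 1)"
    by (simp add: mu_def)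
  then have half: "mu n p \<A> / 2 \<le> x" if "mu n p \<A> / 2 + mu n p \<A> / 2 ^ (k - 1 + 1) \<le> x" for x
    using that by linarith
  from light_subfamily_or_tame_approximation[OF assms(2), where m = "k - 1" and q = "p / 2" and p = p]
  show ?thesis
    using half unfolding tame_iff_light by blast
qed

end
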